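(* Let $\omega>0$ and $p_0>0$, and let $V$ be a real vector space with basis $e_1,e_2,e_3$. Let $\overset{\circ}{\mu}$ be any one of the following four anti-commutative multiplications on $V$ (Lie algebras of Bianchi types I, VII, VIII, IX), where $[\cdot,\cdot]$ denotes $\overset{\circ}{\mu}$: (I) $[e_1,e_2]=0,\ [e_2,e_3]=0,\ [e_3,e_1]=0$; (VII) $[e_1,e_2]=0,\ [e_2,e_3]=e_1,\ [e_3,e_1]=e_2$; (VIII) $[e_1,e_2]=-e_3,\ [e_2,e_3]=e_1,\ [e_3,e_1]=e_2$; (IX) $[e_1,e_2]=e_3,\ [e_2,e_3]=e_1,\ [e_3,e_1]=e_2$. Then $\overset{\circ}{\mu}$ is dynamically rigid over the harmonic oscillator; that is, the evolution $\mu$ of $\overset{\circ}{\mu}$ over the harmonic oscillator satisfies $\mu=\overset{\circ}{\mu}$ for all times $t$.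
   Context: Harmonic oscillator: $H(q,p)=\tfrac12(p^2+\omega^2q^2)$, with equations of motion $\dot q=p$, $\dot p=-\omega^2 q$ and initial conditions $q|_{t=0}=0$, $p|_{t=0}=p_0>0$. The total energy is $E=p_0^2/2$, so $p_0=\sqrt{2E}$. Auxiliary functions: $A_\pm$ are real-valued functions (along the trajectory) satisfying $A_+^2+A_-^2=2\sqrt{2H}$, $A_+^2-A_-^2=2p$, $A_+A_-=\omega q$, with $A_+|_{t=0}=\sqrt{2p_0}$, $A_-|_{t=0}=0$. Structure constants: a multiplication $\mu$ on $V$ has structure constants $\mu_{jk}^i$ given by $\mu(e_j\otimes e_k)=\sum_i\mu_{jk}^i e_i$; similarly for $\overset{\circ}{\mu}$. Evolution over the harmonic oscillator: given an anti-commutative multiplication $\overset{\circ}{\mu}$ on $V$, put $C_1=\tfrac12(\overset{\circ}{\mu}{}_{23}^{2}-\overset{\circ}{\mu}{}_{31}^{1})$, $C_2=\tfrac1{2p_0}(\overset{\circ}{\mu}{}_{13}^{2}+\overset{\circ}{\mu}{}_{23}^{1})$, $C_3=\tfrac1{2p_0}(\overset{\circ}{\mu}{}_{23}^{2}+\overset{\circ}{\mu}{}_{31}^{1})$, $C_4=\tfrac12(\overset{\circ}{\mu}{}_{13}^{2}-\overset{\circ}{\mu}{}_{23}^{1})$, $C_5=\tfrac1{\sqrt{2p_0}}\overset{\circ}{\mu}{}_{12}^{1}$, $C_6=-\tfrac1{\sqrt{2p_0}}\overset{\circ}{\mu}{}_{12}^{2}$, $C_7=\tfrac1{\sqrt{2p_0}}\overset{\circ}{\mu}{}_{13}^{3}$,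 $C_8=-\tfrac1{\sqrt{2p_0}}\overset{\circ}{\mu}{}_{23}^{3}$, $C_9=\overset{\circ}{\mu}{}_{12}^{3}$. The evolution $\mu$ (depending on $t$ through $q,p,A_\pm$) is the anti-commutative multiplication ($\mu_{jk}^i=-\mu_{kj}^i$) with $\mu_{23}^1=C_2p-C_3\omega q-C_4$, $\mu_{13}^2=C_2p-C_3\omega q+C_4$, $\mu_{31}^1=C_2\omega q+C_3p-C_1$, $\mu_{23}^2=C_2\omega q+C_3p+C_1$, $\mu_{12}^1=C_5A_++C_6A_-$, $\mu_{12}^2=C_5A_--C_6A_+$, $\mu_{13}^3=C_7A_++C_8A_-$, $\mu_{23}^3=C_7A_--C_8A_+$, $\mu_{12}^3=C_9$. It satisfies $\mu|_{t=0}=\overset{\circ}{\mu}$. The multiplication $\overset{\circ}{\mu}$ is called dynamically rigid (over the harmonic oscillator) if $\mu=\overset{\circ}{\mu}$ (for all $t$); if $\mu\neq\overset{\circ}{\mu}$, then $\mu$ is called a dynamical deformation of $\overset{\circ}{\mu}$. *)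

theory Defs
  imports "HOL-Analysis.Analysis"
begin

text \<open>The basis \<open>e\<^sub>1, e\<^sub>2, e\<^sub>3\<close> is a function on \<^typ>\<open>nat\<close> of which only the values at
  \<open>1, 2, 3\<close> matter.\<close>

definition is_basis3 :: "(nat \<Rightarrow> 'v::real_vector) \<Rightarrow> bool" where
  "is_basis3 e \<longleftrightarrow>
     inj_on e {1, 2, 3} \<and> independent (e ` {1, 2, 3}) \<and> span (e ` {1, 2, 3}) = UNIV"

definition anticommutative_mult :: "('v::real_vector \<Rightarrow> 'v \<Rightarrow> 'v) \<Rightarrow> bool" where
  "anticommutative_mult \<mu> \<longleftrightarrow> bilinear \<mu> \<and> (\<forall>x y. \<mu> x y = - \<mu> y x)"

text \<open>\<open>struct_const e \<mu> j k i\<close> is the constant with lower indices \<open>j, k\<close> and upper index \<open>i\<close>.\<close>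

definition struct_const ::
  "(nat \<Rightarrow> 'v::real_vector) \<Rightarrow> ('v \<Rightarrow> 'v \<Rightarrow> 'v) \<Rightarrow> nat \<Rightarrow> nat \<Rightarrow> nat \<Rightarrow> real" where
  "struct_const e \<mu> j k i = representation (e ` {1, 2, 3}) (\<mu> (e j) (e k)) (e i)"

lemma struct_const_expansion:
  assumes "is_basis3 e"
  shows "\<mu> (e j) (e k) = (\<Sum>i\<in>{1, 2, 3}. struct_const e \<mu> j k i *\<^sub>R e i)"
proof -
  have "(\<Sum>b\<in>e ` {1, 2, 3}. representation (e ` {1, 2, 3}) (\<mu> (e j) (e k)) b *\<^sub>R b)
      = \<mu> (e j) (e k)"
    by (rule sum_representation_eq) (use assms in \<open>auto simp: is_basis3_def\<close>)
  then show ?thesis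
    using assms by (subst (asm) sum.reindex) (auto simp: is_basis3_def struct_const_def)
qed

definition hamiltonian :: "real \<Rightarrow> real \<Rightarrow> real \<Rightarrow> real" where
  "hamiltonian \<omega> q p = (p\<^sup>2 + \<omega>\<^sup>2 * q\<^sup>2) / 2"

definition oscillator_trajectory ::
  "real \<Rightarrow> real \<Rightarrow> (real \<Rightarrow> real) \<Rightarrow> (real \<Rightarrow> real) \<Rightarrow> bool" where
  "oscillator_trajectory \<omega> p0 q p \<longleftrightarrow>
     (\<forall>t. (q has_real_derivative p t) (at t)) \<and>
     (\<forall>t. (p has_real_derivative - \<omega>\<^sup>2 * q t) (at t)) \<and>
     q 0 = 0 \<and> p 0 = p0"

text \<open>\<open>Ap\<close> and \<open>Am\<close> stand for \<open>A\<^sub>+\<close> and \<open>A\<^sub>-\<close>. The conditions determine the pair at each time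
  only up to a common sign; no continuity in \<open>t\<close> is imposed.\<close>

definition auxiliary_functions ::
  "real \<Rightarrow> real \<Rightarrow> (real \<Rightarrow> real) \<Rightarrow> (real \<Rightarrow> real) \<Rightarrow> (real \<Rightarrow> real) \<Rightarrow> (real \<Rightarrow> real) \<Rightarrow> bool"
where
  "auxiliary_functions \<omega> p0 q p Ap Am \<longleftrightarrow>
     (\<forall>t. (Ap t)\<^sup>2 + (Am t)\<^sup>2 = 2 * sqrt (2 * hamiltonian \<omega> (q t) (p t)) \<and>
          (Ap t)\<^sup>2 - (Am t)\<^sup>2 = 2 * p t \<and>
          Ap t * Am t = \<omega> * q t) \<and>
     Ap 0 = sqrt (2 * p0) \<and> Am 0 = 0"

text \<open>\<open>evolved_mult \<omega> p0 e \<mu>0 q p ap am \<mu>\<close>: \<open>\<mu>\<close> is the multiplication into which \<open>\<mu>0\<close> evolves at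
  an instant where position, momentum and auxiliary functions have the values
  \<open>q\<close>, \<open>p\<close>, \<open>ap\<close>, \<open>am\<close>. By anti-commutativity the nine structure constants listed determine all
  the others.\<close>

definition evolved_mult ::
  "real \<Rightarrow> real \<Rightarrow> (nat \<Rightarrow> 'v::real_vector) \<Rightarrow> ('v \<Rightarrow> 'v \<Rightarrow> 'v) \<Rightarrow>
   real \<Rightarrow> real \<Rightarrow> real \<Rightarrow> real \<Rightarrow> ('v \<Rightarrow> 'v \<Rightarrow> 'v) \<Rightarrow> bool" where
  "evolved_mult \<omega> p0 e \<mu>0 q p ap am \<mu> \<longleftrightarrow>
     (let m0 = struct_const e \<mu>0;
          m = struct_const e \<mu>;
          C1 = (m0 2 3 2 - m0 3 1 1) / 2;
          C2 = (m0 1 3 2 + m0 2 3 1) / (2 * p0);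
          C3 = (m0 2 3 2 + m0 3 1 1) / (2 * p0);
          C4 = (m0 1 3 2 - m0 2 3 1) / 2;
          C5 = m0 1 2 1 / sqrt (2 * p0);
          C6 = - m0 1 2 2 / sqrt (2 * p0);
          C7 = m0 1 3 3 / sqrt (2 * p0);
          C8 = - m0 2 3 3 / sqrt (2 * p0);
          C9 = m0 1 2 3
      in anticommutative_mult \<mu> \<and>
         m 2 3 1 = C2 * p - C3 * \<omega> * q - C4 \<and>
         m 1 3 2 = C2 * p - C3 * \<omega> * q + C4 \<and>
         m 3 1 1 = C2 * \<omega> * q + C3 * p - C1 \<and>
         m 2 3 2 = C2 * \<omega> * q + C3 * p + C1 \<and>
         m 1 2 1 = C5 * ap + C6 * am \<and>
         m 1 2 2 = C5 * am - C6 * ap \<and>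
         m 1 3 3 = C7 * ap + C8 * am \<and>
         m 2 3 3 = C7 * am - C8 * ap \<and>
         m 1 2 3 = C9)"

text \<open>\<open>oscillator_evolution \<omega> p0 e \<mu>0 \<mu>\<close>: the family \<open>\<mu> t\<close> is the evolution of \<open>\<mu>0\<close> along the
  trajectory with initial data \<open>q = 0\<close>, \<open>p = p0\<close>.\<close>

definition oscillator_evolution ::
  "real \<Rightarrow> real \<Rightarrow> (nat \<Rightarrow> 'v::real_vector) \<Rightarrow> ('v \<Rightarrow> 'v \<Rightarrow> 'v) \<Rightarrow>
   (real \<Rightarrow> 'v \<Rightarrow> 'v \<Rightarrow> 'v) \<Rightarrow> bool" where
  "oscillator_evolution \<omega> p0 e \<mu>0 \<mu> \<longleftrightarrow>
     (\<exists>q p Ap Am. oscillator_trajectory \<omega> p0 q p \<and> auxiliary_functions \<omega> p0 q p Ap Am \<and>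
        (\<forall>t. evolved_mult \<omega> p0 e \<mu>0 (q t) (p t) (Ap t) (Am t) (\<mu> t)))"

definition dynamically_rigid ::
  "real \<Rightarrow> real \<Rightarrow> (nat \<Rightarrow> 'v::real_vector) \<Rightarrow> ('v \<Rightarrow> 'v \<Rightarrow> 'v) \<Rightarrow> bool" where
  "dynamically_rigid \<omega> p0 e \<mu>0 \<longleftrightarrow>
     (\<forall>\<mu>. oscillator_evolution \<omega> p0 e \<mu>0 \<mu> \<longrightarrow> (\<forall>t. \<mu> t = \<mu>0))"

text \<open>Evolutions exist, so that rigidity is never vacuous.\<close>

lemma ex_anticommutative_mult:
  assumes e: "is_basis3 e"
  shows "\<exists>\<mu>. anticommutative_mult \<mu> \<and> \<mu> (e 1) (e 2) = a \<and> \<mu> (e 2) (e 3) = b \<and> \<mu> (e 3) (e 1) = c"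
proof -
  define r where "r i x = representation (e ` {1, 2, 3}) x (e i)" for i :: nat and x
  define \<mu> where "\<mu> x y = (r 1 x * r 2 y - r 2 x * r 1 y) *\<^sub>R a + (r 2 x * r 3 y - r 3 x * r 2 y) *\<^sub>R b
      + (r 3 x * r 1 y - r 1 x * r 3 y) *\<^sub>R c" for x y
  have ind: "independent (e ` {1, 2, 3})" and sp: "span (e ` {1, 2, 3}) = UNIV"
    and inj: "inj_on e {1, 2, 3}"
    using e by (auto simp: is_basis3_def)
  have radd: "r i (x + y) = r i x + r i y" and rscale: "r i (s *\<^sub>R x) = s * r i x" for i x y s
    using ind sp by (simp_all add: r_def representation_add representation_scale)
  have rb: "r i (e j) = (if i = j then 1 else 0)" if "i \<in> {1, 2, 3}" "j \<in> {1, 2, 3}" for i j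
    using that inj ind by (auto simp: r_def representation_basis dest: inj_onD)
  have "anticommutative_mult \<mu>"
    unfolding anticommutative_mult_def bilinear_def linear_iff \<mu>_def
    by (auto simp: radd rscale algebra_simps)
  moreover have "\<mu> (e 1) (e 2) = a \<and> \<mu> (e 2) (e 3) = b \<and> \<mu> (e 3) (e 1) = c"
    by (simp add: \<mu>_def rb)
  ultimately show ?thesis by blast
qed

lemma anticommutative_mult_struct_const:
  assumes "is_basis3 e" "anticommutative_mult \<mu>"
  shows "struct_const e \<mu> k j i = - struct_const e \<mu> j k i"
proof -
  have "\<mu> (e k) (e j) = - \<mu> (e j) (e k)"
    using assms(2) unfolding anticommutative_mult_def by blast
  then show ?thesis
    using assms(1) by (simp add: struct_const_def is_basis3_def representation_neg)
qed

lemma ex_mult_with_struct_const: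
  assumes e: "is_basis3 e"
  shows "\<exists>\<mu>. anticommutative_mult \<mu> \<and>
     (\<forall>i\<in>{1, 2, 3}. struct_const e \<mu> 1 2 i = a i \<and> struct_const e \<mu> 2 3 i = b i \<and>
        struct_const e \<mu> 3 1 i = c i)"
proof -
  define v where "v f = (\<Sum>i\<in>{1, 2, 3}. f i *\<^sub>R e i)" for f :: "nat \<Rightarrow> real"
  obtain \<mu> where \<mu>: "anticommutative_mult \<mu>" "\<mu> (e 1) (e 2) = v a" "\<mu> (e 2) (e 3) = v b"
    "\<mu> (e 3) (e 1) = v c"
    using ex_anticommutative_mult[OF e] by metis
  have ind: "independent (e ` {1, 2, 3})" and sp: "span (e ` {1, 2, 3}) = UNIV"
    and inj: "inj_on e {1, 2, 3}"
    using e by (auto simp: is_basis3_def)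
  have rb: "representation (e ` {1, 2, 3}) (e j) (e i) = (if i = j then 1 else 0)"
    if "i \<in> {1, 2, 3}" "j \<in> {1, 2, 3}" for i j
    using that inj ind by (auto simp: representation_basis dest: inj_onD)
  have "representation (e ` {1, 2, 3}) (v f) (e i) = f i" if i: "i \<in> {1, 2, 3}" for f i
  proof -
    define B where "B = e ` {1, 2, 3}"
    have "representation B (v f) (e i) = (\<Sum>j\<in>{1, 2, 3}. f j * representation B (e j) (e i))"
      using ind sp unfolding B_def[symmetric]
      by (simp add: v_def representation_add representation_scale)
    also have "\<dots> = (\<Sum>j\<in>{1, 2, 3}. f j * (if i = j then 1 else 0))"
      unfolding B_def by (intro sum.cong refl arg_cong2[where f = "(*)"] rb i)
    also have "\<dots> = f i"
      using i by auto
    finally show ?thesis by (simp add: B_def)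
  qed
  then show ?thesis
    using \<mu> by (auto simp: struct_const_def intro!: exI[of _ \<mu>])
qed

lemma oscillator_evolution_exists:
  assumes "\<omega> > 0" "p0 > 0" "is_basis3 e" "anticommutative_mult \<mu>0"
  shows "\<exists>\<mu>. oscillator_evolution \<omega> p0 e \<mu>0 \<mu>"
proof -
  define q where "q t = p0 / \<omega> * sin (\<omega> * t)" for t
  define p where "p t = p0 * cos (\<omega> * t)" for t
  define Ap where "Ap t = sqrt (2 * p0) * cos (\<omega> * t / 2)" for t
  define Am where "Am t = sqrt (2 * p0) * sin (\<omega> * t / 2)" for t
  have "oscillator_trajectory \<omega> p0 q p"
    unfolding oscillator_trajectory_def q_def p_def using assms(1)
    by (auto intro!: derivative_eq_intros simp: power2_eq_square)
  moreover have "auxiliary_functions \<omega> p0 q p Ap Am"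
  proof -
    have half: "cos (\<omega> * t) = (cos (\<omega> * t / 2))\<^sup>2 - (sin (\<omega> * t / 2))\<^sup>2"
      "sin (\<omega> * t) = 2 * sin (\<omega> * t / 2) * cos (\<omega> * t / 2)" for t
      using cos_double[of "\<omega> * t / 2"] sin_double[of "\<omega> * t / 2"] by simp_all
    have "2 * hamiltonian \<omega> (q t) (p t) = (p0 * cos (\<omega> * t))\<^sup>2 + (\<omega> * q t)\<^sup>2" for t
      by (simp add: hamiltonian_def p_def power_mult_distrib)
    moreover have "\<omega> * q t = p0 * sin (\<omega> * t)" for t
      using assms(1) by (simp add: q_def)
    ultimately have "2 * hamiltonian \<omega> (q t) (p t) = p0\<^sup>2 * ((cos (\<omega> * t))\<^sup>2 + (sin (\<omega> * t))\<^sup>2)" for t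
      by (simp only: power_mult_distrib distrib_left)
    then have H: "sqrt (2 * hamiltonian \<omega> (q t) (p t)) = p0" for t
      using assms(2) by simp
    have s2: "(sqrt (2 * p0))\<^sup>2 = 2 * p0"
      using assms(2) by simp
    have "(Ap t)\<^sup>2 + (Am t)\<^sup>2 = 2 * p0 * ((sin (\<omega> * t / 2))\<^sup>2 + (cos (\<omega> * t / 2))\<^sup>2)" for t
      unfolding Ap_def Am_def power_mult_distrib s2 by (simp only: distrib_left add.commute)
    then have 1: "(Ap t)\<^sup>2 + (Am t)\<^sup>2 = 2 * p0" for t
      by (simp only: sin_cos_squared_add mult_1_right)
    have 2: "(Ap t)\<^sup>2 - (Am t)\<^sup>2 = 2 * p t" for t
      unfolding Ap_def Am_def p_def power_mult_distrib half s2 by (simp add: algebra_simps)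
    have 3: "Ap t * Am t = \<omega> * q t" for t
      using assms(1,2) unfolding Ap_def Am_def q_def half by (simp add: field_simps)
    show ?thesis
      unfolding auxiliary_functions_def H using 1 2 3 by (simp add: Ap_def Am_def)
  qed
  moreover have "\<exists>\<mu>. evolved_mult \<omega> p0 e \<mu>0 q p ap am \<mu>" for q p ap am
  proof -
    have flip: "struct_const e \<mu> 1 3 i = x \<longleftrightarrow> struct_const e \<mu> 3 1 i = - x"
      if "anticommutative_mult \<mu>" for \<mu> i x
      using anticommutative_mult_struct_const[OF assms(3) that, of 1 3 i] by auto
    define F where "F x y z i = (if i = 1 then x else if i = 2 then y else z)"
      for x y z :: real and i :: nat
    have ex: "\<exists>\<mu>. anticommutative_mult \<mu> \<and> struct_const e \<mu> 2 3 1 = b1 \<and>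
      struct_const e \<mu> 1 3 2 = c2 \<and> struct_const e \<mu> 3 1 1 = c1 \<and> struct_const e \<mu> 2 3 2 = b2 \<and>
      struct_const e \<mu> 1 2 1 = a1 \<and> struct_const e \<mu> 1 2 2 = a2 \<and> struct_const e \<mu> 1 3 3 = c3 \<and>
      struct_const e \<mu> 2 3 3 = b3 \<and> struct_const e \<mu> 1 2 3 = a3" for a1 a2 a3 b1 b2 b3 c1 c2 c3
    proof -
      obtain \<mu> where "anticommutative_mult \<mu>"
        "\<forall>i\<in>{1, 2, 3}. struct_const e \<mu> 1 2 i = F a1 a2 a3 i \<and>
           struct_const e \<mu> 2 3 i = F b1 b2 b3 i \<and> struct_const e \<mu> 3 1 i = F c1 (- c2) (- c3) i"
        using ex_mult_with_struct_const[OF assms(3)] by metis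
      then show ?thesis
        by (intro exI[of _ \<mu>]) (auto simp: F_def flip simp del: One_nat_def)
    qed
    show ?thesis
      unfolding evolved_mult_def Let_def by (rule ex)
  qed
  then have "\<exists>\<mu>. \<forall>t. evolved_mult \<omega> p0 e \<mu>0 (q t) (p t) (Ap t) (Am t) (\<mu> t)"
    by (intro choice allI)
  ultimately show ?thesis
    unfolding oscillator_evolution_def by blast
qed

definition bianchi_I :: "(nat \<Rightarrow> 'v::real_vector) \<Rightarrow> ('v \<Rightarrow> 'v \<Rightarrow> 'v) \<Rightarrow> bool" where
  "bianchi_I e \<mu> \<longleftrightarrow> \<mu> (e 1) (e 2) = 0 \<and> \<mu> (e 2) (e 3) = 0 \<and> \<mu> (e 3) (e 1) = 0"

definition bianchi_VII :: "(nat \<Rightarrow> 'v::real_vector) \<Rightarrow> ('v \<Rightarrow> 'v \<Rightarrow> 'v) \<Rightarrow> bool" where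
  "bianchi_VII e \<mu> \<longleftrightarrow> \<mu> (e 1) (e 2) = 0 \<and> \<mu> (e 2) (e 3) = e 1 \<and> \<mu> (e 3) (e 1) = e 2"

definition bianchi_VIII :: "(nat \<Rightarrow> 'v::real_vector) \<Rightarrow> ('v \<Rightarrow> 'v \<Rightarrow> 'v) \<Rightarrow> bool" where
  "bianchi_VIII e \<mu> \<longleftrightarrow> \<mu> (e 1) (e 2) = - e 3 \<and> \<mu> (e 2) (e 3) = e 1 \<and> \<mu> (e 3) (e 1) = e 2"

definition bianchi_IX :: "(nat \<Rightarrow> 'v::real_vector) \<Rightarrow> ('v \<Rightarrow> 'v \<Rightarrow> 'v) \<Rightarrow> bool" where
  "bianchi_IX e \<mu> \<longleftrightarrow> \<mu> (e 1) (e 2) = e 3 \<and> \<mu> (e 2) (e 3) = e 1 \<and> \<mu> (e 3) (e 1) = e 2"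

end

theory Submission
  imports Defs
begin

text \<open>Reads structure constants off a bracket table: coordinates are linear, and the
  coordinates of a basis vector are a Kronecker delta.\<close>

lemma struct_const_scaleR_basis:
  assumes "is_basis3 e" "\<mu> (e j) (e k) = c *\<^sub>R e l" "i \<in> {1, 2, 3}" "l \<in> {1, 2, 3}"
  shows "struct_const e \<mu> j k i = (if i = l then c else 0)"
proof -
  have "independent (e ` {1, 2, 3})" "span (e ` {1, 2, 3}) = UNIV"
    and inj: "inj_on e {1, 2, 3}"
    using assms(1) by (auto simp: is_basis3_def)
  then have "struct_const e \<mu> j k i = c * (if e i = e l then 1 else 0)"
    using assms(4) unfolding struct_const_def assms(2)
    by (subst representation_scale) (auto simp: representation_basis)
  \<comment> \<open>The delta compares vectors; injectivity of the indexing turns it into a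
    comparison of indices.\<close>
  also have "e i = e l \<longleftrightarrow> i = l"
    using inj_on_eq_iff[OF inj] assms(3,4) by blast
  finally show ?thesis by simp
qed

text \<open>Antisymmetry yields the reversed brackets and kills the diagonal ones, so the three
  cyclic brackets fix all nine products of basis vectors, and bilinearity extends the agreement to
  their span.\<close>

lemma anticommutative_mult_eqI:
  assumes e: "is_basis3 e" and mu: "anticommutative_mult \<mu>" and nu: "anticommutative_mult \<nu>"
    and "\<mu> (e 1) (e 2) = \<nu> (e 1) (e 2)" "\<mu> (e 2) (e 3) = \<nu> (e 2) (e 3)"
      "\<mu> (e 3) (e 1) = \<nu> (e 3) (e 1)"
  shows "\<mu> = \<nu>"
proof -
  have bil: "bilinear \<mu>" "bilinear \<nu>" and sp: "span (e ` {1, 2, 3}) = UNIV"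
    and anti: "\<mu> x y = - \<mu> y x" "\<nu> x y = - \<nu> y x" for x y
    using e mu nu unfolding is_basis3_def anticommutative_mult_def by blast+
  have diag: "\<mu> x x = 0" "\<nu> x x = 0" for x
  proof -
    \<comment> \<open>Antisymmetry at \<open>x\<close>, \<open>x\<close> gives only twice the
      square; over the reals the factor 2 can be cancelled.\<close>
    have "\<mu> x x + \<mu> x x = 0" "\<nu> x x + \<nu> x x = 0"
      using anti[of x x] by (metis add.right_inverse)+
    then show "\<mu> x x = 0" "\<nu> x x = 0"
      by (simp_all flip: scaleR_2)
  qed
  have eq: "\<mu> (e i) (e j) = \<nu> (e i) (e j)" if "i \<in> {1, 2, 3}" "j \<in> {1, 2, 3}" for i j
    using that assms(4-6) diag anti[of "e 2" "e 1"] anti[of "e 3" "e 2"] anti[of "e 1" "e 3"]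
    by auto
  have "\<mu> x y = \<nu> x y" for x y
    by (rule bilinear_eq[OF bil, of UNIV "e ` {1, 2, 3}" UNIV "e ` {1, 2, 3}"])
      (use eq sp in blast)+
  then show ?thesis by blast
qed

lemma anticommutative_mult_eq_if_struct_const_eq:
  assumes "is_basis3 e" "anticommutative_mult \<mu>" "anticommutative_mult \<nu>"
    and "\<And>i. i \<in> {1, 2, 3} \<Longrightarrow> struct_const e \<mu> 1 2 i = struct_const e \<nu> 1 2 i"
    and "\<And>i. i \<in> {1, 2, 3} \<Longrightarrow> struct_const e \<mu> 2 3 i = struct_const e \<nu> 2 3 i"
    and "\<And>i. i \<in> {1, 2, 3} \<Longrightarrow> struct_const e \<mu> 3 1 i = struct_const e \<nu> 3 1 i"
  shows "\<mu> = \<nu>"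
proof (rule anticommutative_mult_eqI[OF assms(1-3)])
  show "\<mu> (e 1) (e 2) = \<nu> (e 1) (e 2)"
    \<comment> \<open>The multiplication stays schematic, so that both sides are expanded; the
      congruence rule supplies the range of \<open>i\<close>.\<close>
    unfolding struct_const_expansion[OF assms(1), of _ 1 2] by (simp only: assms(4) cong: sum.cong)
  show "\<mu> (e 2) (e 3) = \<nu> (e 2) (e 3)"
    unfolding struct_const_expansion[OF assms(1), of _ 2 3] by (simp only: assms(5) cong: sum.cong)
  show "\<mu> (e 3) (e 1) = \<nu> (e 3) (e 1)"
    unfolding struct_const_expansion[OF assms(1), of _ 3 1] by (simp only: assms(6) cong: sum.cong)
qed

text \<open>Here only \<open>C4 = - d\<close> and \<open>C9 = c\<close> survive, and these are the two terms of the evolution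
  that do not involve \<open>q\<close>, \<open>p\<close>, \<open>A\<^sub>+\<close>, \<open>A\<^sub>-\<close>.\<close>

lemma evolved_mult_diagonal:
  assumes e: "is_basis3 e" and mu0: "anticommutative_mult \<mu>0"
    and b: "\<mu>0 (e 1) (e 2) = c *\<^sub>R e 3" "\<mu>0 (e 2) (e 3) = d *\<^sub>R e 1" "\<mu>0 (e 3) (e 1) = d *\<^sub>R e 2"
    and ev: "evolved_mult \<omega> p0 e \<mu>0 q p ap am \<mu>"
  shows "\<mu> = \<mu>0"
proof -
  have mu: "anticommutative_mult \<mu>"
    using ev by (simp add: evolved_mult_def Let_def)
  have m0: "struct_const e \<mu>0 1 2 i = (if i = 3 then c else 0)"
      "struct_const e \<mu>0 2 3 i = (if i = 1 then d else 0)"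
      "struct_const e \<mu>0 3 1 i = (if i = 2 then d else 0)" if "i \<in> {1, 2, 3}" for i
    using struct_const_scaleR_basis[of e \<mu>0 1 2 _ 3, OF e b(1) that]
      struct_const_scaleR_basis[of e \<mu>0 2 3 _ 1, OF e b(2) that]
      struct_const_scaleR_basis[of e \<mu>0 3 1 _ 2, OF e b(3) that]
    by auto
  \<comment> \<open>The evolution prescribes some constants with lower indices 1, 3, while the
    comparison of multiplications uses the cyclic order 3, 1.\<close>
  have flip: "struct_const e \<nu> 1 3 i = - struct_const e \<nu> 3 1 i"
    if "anticommutative_mult \<nu>" for \<nu> i
    by (rule anticommutative_mult_struct_const[OF e that])
  have z: "struct_const e \<mu>0 1 2 1 = 0" "struct_const e \<mu>0 1 2 2 = 0"
      "struct_const e \<mu>0 1 2 3 = c" "struct_const e \<mu>0 2 3 1 = d" "struct_const e \<mu>0 2 3 2 = 0"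
      "struct_const e \<mu>0 2 3 3 = 0" "struct_const e \<mu>0 3 1 1 = 0" "struct_const e \<mu>0 3 1 2 = d"
      "struct_const e \<mu>0 3 1 3 = 0" "struct_const e \<mu>0 1 3 2 = - d" "struct_const e \<mu>0 1 3 3 = 0"
    by (simp_all add: m0 flip[OF mu0] del: One_nat_def)
  \<comment> \<open>The cancellation behind rigidity is
    \<open>C2 = (- d + d) / (2 * p0) = 0\<close>: it needs the same \<open>d\<close> in the brackets
    giving \<open>e 1\<close> and \<open>e 2\<close>.\<close>
  have "struct_const e \<mu> 1 2 1 = 0 \<and> struct_const e \<mu> 1 2 2 = 0 \<and>
      struct_const e \<mu> 1 2 3 = c \<and> struct_const e \<mu> 2 3 1 = d \<and> struct_const e \<mu> 2 3 2 = 0 \<and>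
      struct_const e \<mu> 2 3 3 = 0 \<and> struct_const e \<mu> 3 1 1 = 0 \<and> struct_const e \<mu> 1 3 2 = - d \<and>
      struct_const e \<mu> 1 3 3 = 0"
    using ev unfolding evolved_mult_def Let_def z by simp
  then have eq: "struct_const e \<mu> 1 2 i = struct_const e \<mu>0 1 2 i \<and>
      struct_const e \<mu> 2 3 i = struct_const e \<mu>0 2 3 i \<and>
      struct_const e \<mu> 3 1 i = struct_const e \<mu>0 3 1 i" if "i \<in> {1, 2, 3}" for i
    using that z unfolding flip[OF mu] by (elim insertE emptyE) (simp_all del: One_nat_def)
  show ?thesis
    by (rule anticommutative_mult_eq_if_struct_const_eq[OF e mu mu0]) (use eq in blast)+
qed

theorem theorem8p1:
  fixes \<omega> p0 :: real
    and e :: "nat \<Rightarrow> 'v::real_vector"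
    and \<mu>0 :: "'v \<Rightarrow> 'v \<Rightarrow> 'v"
  assumes "\<omega> > 0" and "p0 > 0"
    and "is_basis3 e"
    and "anticommutative_mult \<mu>0"
    and "bianchi_I e \<mu>0 \<or> bianchi_VII e \<mu>0 \<or> bianchi_VIII e \<mu>0 \<or> bianchi_IX e \<mu>0"
  shows "dynamically_rigid \<omega> p0 e \<mu>0"
proof -
  \<comment> \<open>Types I, VII, VIII, IX are the cases (0, 0), (0, 1), (-1, 1), (1, 1) of one
    family with parameters (\<open>c\<close>, \<open>d\<close>).\<close>
  have "(\<mu>0 (e 1) (e 2) = 0 *\<^sub>R e 3 \<and> \<mu>0 (e 2) (e 3) = 0 *\<^sub>R e 1 \<and> \<mu>0 (e 3) (e 1) = 0 *\<^sub>R e 2) \<or>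
      (\<mu>0 (e 1) (e 2) = 0 *\<^sub>R e 3 \<and> \<mu>0 (e 2) (e 3) = 1 *\<^sub>R e 1 \<and> \<mu>0 (e 3) (e 1) = 1 *\<^sub>R e 2) \<or>
      (\<mu>0 (e 1) (e 2) = (-1) *\<^sub>R e 3 \<and> \<mu>0 (e 2) (e 3) = 1 *\<^sub>R e 1 \<and> \<mu>0 (e 3) (e 1) = 1 *\<^sub>R e 2) \<or>
      (\<mu>0 (e 1) (e 2) = 1 *\<^sub>R e 3 \<and> \<mu>0 (e 2) (e 3) = 1 *\<^sub>R e 1 \<and> \<mu>0 (e 3) (e 1) = 1 *\<^sub>R e 2)"
    using assms(5)
    by (simp add: bianchi_I_def bianchi_VII_def bianchi_VIII_def bianchi_IX_def)
  then obtain c d where "\<mu>0 (e 1) (e 2) = c *\<^sub>R e 3" "\<mu>0 (e 2) (e 3) = d *\<^sub>R e 1"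
    "\<mu>0 (e 3) (e 1) = d *\<^sub>R e 2"
    by blast
  then show ?thesis
    \<comment> \<open>Applied separately at each time \<open>t\<close>, with the values of the
      trajectory and of the auxiliary functions there.\<close>
    using evolved_mult_diagonal[OF assms(3,4)]
    unfolding dynamically_rigid_def oscillator_evolution_def by blast
qed

end
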